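(* Let $T=ABC$ be a non-equilateral triangle labelled counterclockwise, and let $T^{(0)}=T$, $T^{(n+1)}=$ the second Brocard triangle of $T^{(n)}$, with Brocard points $\Omega_1^{(n)},\Omega_2^{(n)}$. Then the points $\Omega_1,\Omega_2',\Omega_1'',\Omega_2''',\dots$ (that is, $\Omega_1^{(n)}$ for $n$ even and $\Omega_2^{(n)}$ for $n$ odd) all lie on the first Beltrami circle $\mathcal{C}_1$ of $T$, and the points $\Omega_2,\Omega_1',\Omega_2'',\Omega_1''',\dots$ (that is, $\Omega_2^{(n)}$ for $n$ even and $\Omega_1^{(n)}$ for $n$ odd) all lie on the second Beltrami circle $\mathcal{C}_2$ of $T$.
   Context: For a triangle $ABC$ labelled in a given order, the Brocard angle $\omega$ and Brocard points $\Omega_1,\Omega_2$ (inside the triangle) are defined by $\angle\Omega_1AB=\angle\Omega_1BC=\angle\Omega_1CA=\omega$ and $\angle\Omega_2BA=\angle\Omega_2CB=\angle\Omega_2AC=\omega$. $X_3$ is the circumcenter and $X_6$ the symmedian point. The Brocard circle $\mathcal{K}$ is the circle through $X_3,\Omega_1,\Omega_2$; it has $X_3X_6$ as a diameter. The second Brocard triangle of $ABC$ is the triangle $A'B'C'$, where $A'$ is the intersection, other than $X_6$, of the line $AX_6$ with $\mathcal{K}$ (and $A'=X_6$ if the line is tangent to $\mathcal{K}$), similarly $B'$ and $C'$. Its Brocard points are taken with respect to the labelling $A',B',C'$ (so $\angle\Omega_1'A'B'=\angle\Omega_1'B'C'=\angle\Omega_1'C'A'$), and similarly at each iteration. The Beltrami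 points $P_2$ and $U_2$ of $T$ are the inverses of $\Omega_1$ and $\Omega_2$, respectively, in the circumcircle of $T$. The Beltrami circles of $T$ are the two circles centered at the Beltrami points such that $\mathcal{C}_1$ passes through $\Omega_1$ and $P_2$, and $\mathcal{C}_2$ passes through $\Omega_2$ and $U_2$; that is, $\mathcal{C}_1$ is the circle centered at $U_2$ through $\Omega_1$, and $\mathcal{C}_2$ is the circle centered at $P_2$ through $\Omega_2$. *)

theory Defs
  imports "HOL-Analysis.Analysis"
begin

text \<open>The Euclidean plane is \<^typ>\<open>complex\<close>; a labelled triangle is its triple of vertices.\<close>

type_synonym triangle = "complex \<times> complex \<times> complex"

fun counterclockwise :: "triangle \<Rightarrow> bool" where
  "counterclockwise (A, B, C) \<longleftrightarrow> Im (cnj (B - A) * (C - A)) > 0"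

fun equilateral :: "triangle \<Rightarrow> bool" where
  "equilateral (A, B, C) \<longleftrightarrow> dist A B = dist B C \<and> dist B C = dist C A"

text \<open>The unoriented angle at the middle point, with values between \<open>0\<close> and \<open>pi\<close>.\<close>

definition angle :: "complex \<Rightarrow> complex \<Rightarrow> complex \<Rightarrow> real" where
  "angle P Q R = arccos (((P - Q) \<bullet> (R - Q)) / (norm (P - Q) * norm (R - Q)))"

fun circumcenter :: "triangle \<Rightarrow> complex" where
  "circumcenter (A, B, C) = (THE P. dist P A = dist P B \<and> dist P B = dist P C)"

fun circumradius :: "triangle \<Rightarrow> real" where
  "circumradius (A, B, C) = dist (circumcenter (A, B, C)) A"

definition circumcircle :: "triangle \<Rightarrow> complex set" where
  "circumcircle T = sphere (circumcenter T) (circumradius T)"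

text \<open>Reflection of \<open>P\<close> in the line through \<open>Q\<close> with direction \<open>u \<noteq> 0\<close>; if \<open>norm u = 1\<close>, then
  \<open>u / cnj u = u\<^sup>2\<close>.\<close>

definition reflect_in_line :: "complex \<Rightarrow> complex \<Rightarrow> complex \<Rightarrow> complex" where
  "reflect_in_line Q u P = Q + u / cnj u * cnj (P - Q)"

text \<open>The symmedian through \<open>A\<close> is the reflection of the median from \<open>A\<close> in the internal angle
  bisector at \<open>A\<close>, which has direction \<open>sgn (B - A) + sgn (C - A)\<close>.\<close>

definition symmedian :: "complex \<Rightarrow> complex \<Rightarrow> complex \<Rightarrow> complex set" where
  "symmedian A B C =
     affine hull {A, reflect_in_line A (sgn (B - A) + sgn (C - A)) (midpoint B C)}"

fun symmedian_point :: "triangle \<Rightarrow> complex" where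
  "symmedian_point (A, B, C) =
     (THE P. P \<in> symmedian A B C \<and> P \<in> symmedian B C A \<and> P \<in> symmedian C A B)"

text \<open>Each system of angle equations already has a unique solution inside the triangle; the common
  value of the angles is the Brocard angle, the same one for both points.\<close>

fun brocard_point1 :: "triangle \<Rightarrow> complex" where
  "brocard_point1 (A, B, C) =
     (THE P. P \<in> interior (convex hull {A, B, C}) \<and>
        angle P A B = angle P B C \<and> angle P B C = angle P C A)"

fun brocard_point2 :: "triangle \<Rightarrow> complex" where
  "brocard_point2 (A, B, C) =
     (THE P. P \<in> interior (convex hull {A, B, C}) \<and>
        angle P B A = angle P C B \<and> angle P C B = angle P A C)"

definition brocard_circle :: "triangle \<Rightarrow> complex set" where
  "brocard_circle T = circumcircle (circumcenter T, brocard_point1 T, brocard_point2 T)"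

text \<open>For \<open>S\<close> on the circle \<open>K\<close> and \<open>A \<noteq> S\<close>: the second intersection of the line \<open>AS\<close> with \<open>K\<close>,
  which is \<open>S\<close> itself if the line is tangent to \<open>K\<close>, that is, meets \<open>K\<close> in \<open>S\<close> only.\<close>

definition second_intersection :: "complex \<Rightarrow> complex \<Rightarrow> complex set \<Rightarrow> complex" where
  "second_intersection A S K =
     (if affine hull {A, S} \<inter> K = {S} then S
      else (THE P. P \<in> affine hull {A, S} \<inter> K \<and> P \<noteq> S))"

fun second_brocard_triangle :: "triangle \<Rightarrow> triangle" where
  "second_brocard_triangle (A, B, C) =
     (let S = symmedian_point (A, B, C); K = brocard_circle (A, B, C)
      in (second_intersection A S K, second_intersection B S K, second_intersection C S K))"

definition inverse_in_circle :: "complex \<Rightarrow> real \<Rightarrow> complex \<Rightarrow> complex" where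
  "inverse_in_circle Q r P = Q + (r\<^sup>2 / (dist Q P)\<^sup>2) *\<^sub>R (P - Q)"

definition beltrami_P2 :: "triangle \<Rightarrow> complex" where
  "beltrami_P2 T = inverse_in_circle (circumcenter T) (circumradius T) (brocard_point1 T)"

definition beltrami_U2 :: "triangle \<Rightarrow> complex" where
  "beltrami_U2 T = inverse_in_circle (circumcenter T) (circumradius T) (brocard_point2 T)"

text \<open>Each circle is centered at the Beltrami point of the other index.\<close>

definition beltrami_circle1 :: "triangle \<Rightarrow> complex set" where
  "beltrami_circle1 T = sphere (beltrami_U2 T) (dist (beltrami_U2 T) (brocard_point1 T))"

definition beltrami_circle2 :: "triangle \<Rightarrow> complex set" where
  "beltrami_circle2 T = sphere (beltrami_P2 T) (dist (beltrami_P2 T) (brocard_point2 T))"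

end

theory Submission
  imports Defs
begin

text \<open>Send the two isodynamic points of the triangle to \<open>0\<close> and \<open>\<infinity>\<close> by a Moebius map, normalised
  so that the point at infinity of the plane goes to \<open>1\<close>. The vertices become \<open>u, w u, w\<^sup>2 u\<close> for a
  primitive cube root of unity \<open>w\<close> and some \<open>u\<close> with \<open>0 < \<bar>u\<bar> < 1\<close>. In this coordinate the
  circumcenter is \<open>r = \<bar>u\<bar>\<^sup>2\<close>, the symmedian point is \<open>- r\<close>, the Brocard points are \<open>w\<^sup>2 r\<close> and
  \<open>w r\<close>, and the Brocard circle is the circle of radius \<open>r\<close> around \<open>0\<close>. The second
  Brocard triangle has the vertices \<open>u\<^sup>2, w\<^sup>2 u\<^sup>2, w\<^sup>4 u\<^sup>2\<close>: the construction is squaring, with \<open>w\<close> and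
  \<open>w\<^sup>2\<close> exchanged. So the two alternating sequences of Brocard points stay on the lines
  \<open>\<real> w\<^sup>2\<close> and \<open>\<real> w\<close>, which are the Beltrami circles: the Beltrami points are \<open>w\<^sup>2\<close> and \<open>w\<close>.\<close>

subsection \<open>Triangle centers from their characteristic equations\<close>

text \<open>Non-collinearity is stated below as nonvanishing of this number, without a sign, so that
  the lemmas also apply after two vertices are exchanged.\<close>

definition signed_area2 :: "complex \<Rightarrow> complex \<Rightarrow> complex \<Rightarrow> real" where
  "signed_area2 A B C = Im (cnj (B - A) * (C - A))"

lemma signed_area2_rotate: "signed_area2 B C A = signed_area2 A B C"
  by (simp add: signed_area2_def algebra_simps)

lemma collinear_imp_signed_area2_eq_0:
  assumes "collinear {A, B, C}"
  shows "signed_area2 A B C = 0"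
proof -
  obtain u where u: "\<forall>x\<in>{A, B, C}. \<forall>y\<in>{A, B, C}. \<exists>c. x - y = c *\<^sub>R u"
    using assms unfolding collinear_def by blast
  then obtain s t where "B - A = s *\<^sub>R u" "C - A = t *\<^sub>R u" by blast
  then show ?thesis by (simp add: signed_area2_def algebra_simps)
qed

text \<open>The barycentric coordinates of \<open>P\<close> are quotients of signed areas; dividing
  by the area of the whole triangle makes the criterion independent of orientation.\<close>

lemma interior_triangle_signed_area2:
  assumes S: "signed_area2 A B C \<noteq> 0"
  shows "P \<in> interior (convex hull {A, B, C}) \<longleftrightarrow>
    signed_area2 A B P / signed_area2 A B C > 0 \<and> signed_area2 B C P / signed_area2 A B C > 0 \<and>
    signed_area2 C A P / signed_area2 A B C > 0"
    (is "_ \<longleftrightarrow> ?z > 0 \<and> ?x > 0 \<and> ?y > 0")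
proof -
  define D where "D = signed_area2 A B C"
  have "\<not> collinear {A, B, C}"
    using S collinear_imp_signed_area2_eq_0 by blast
  then have int: "interior (convex hull {A, B, C}) =
      {v. \<exists>x y z. 0 < x \<and> 0 < y \<and> 0 < z \<and> x + y + z = 1 \<and> x *\<^sub>R A + y *\<^sub>R B + z *\<^sub>R C = v}"
    by (rule interior_convex_hull_3_minimal) simp
  show ?thesis
  proof
    assume "P \<in> interior (convex hull {A, B, C})"
    then obtain x y z where pos: "0 < x" "0 < y" "0 < z" and sum: "x + y + z = 1"
      and P: "P = x *\<^sub>R A + y *\<^sub>R B + z *\<^sub>R C"
      using int by auto
    have x: "x = 1 - y - z" using sum by simp
    have "signed_area2 A B P = z * D" "signed_area2 B C P = x * D" "signed_area2 C A P = y * D"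
      unfolding P x D_def by (simp_all add: signed_area2_def algebra_simps)
    then show "?z > 0 \<and> ?x > 0 \<and> ?y > 0"
      using pos S by (simp add: D_def)
  next
    assume *: "?z > 0 \<and> ?x > 0 \<and> ?y > 0"
    have D: "D \<noteq> 0" using S by (simp add: D_def)
    have sum: "signed_area2 A B P + signed_area2 B C P + signed_area2 C A P = D"
      unfolding D_def by (simp add: signed_area2_def algebra_simps)
    have sum1: "?x + ?y + ?z = 1"
      using sum D by (simp add: D_def[symmetric] add_divide_distrib[symmetric] add_ac)
    have "D *\<^sub>R P = signed_area2 B C P *\<^sub>R A + signed_area2 C A P *\<^sub>R B + signed_area2 A B P *\<^sub>R C"
      unfolding D_def by (rule complex_eqI) (simp_all add: signed_area2_def algebra_simps)
    then have "(1 / D) *\<^sub>R (D *\<^sub>R P) = (1 / D) *\<^sub>R (signed_area2 B C P *\<^sub>R A + signed_area2 C A P *\<^sub>R B + signed_area2 A B P *\<^sub>R C)"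
      by simp
    then have "P = ?x *\<^sub>R A + ?y *\<^sub>R B + ?z *\<^sub>R C"
      using D by (simp add: D_def[symmetric] scaleR_add_right)
    then show "P \<in> interior (convex hull {A, B, C})"
      unfolding int using * sum1
      by (intro CollectI exI[of _ ?x] exI[of _ ?y] exI[of _ ?z]) metis
  qed
qed

text \<open>The difference of two equidistant points is orthogonal to two independent sides, hence
  zero.\<close>

lemma circumcenter_eqI:
  assumes "signed_area2 A B C \<noteq> 0" "dist P A = dist P B" "dist P B = dist P C"
  shows "circumcenter (A, B, C) = P"
  unfolding circumcenter.simps
proof (rule the_equality)
  fix Q assume Q: "dist Q A = dist Q B \<and> dist Q B = dist Q C"
  have *: "Re (cnj (Q - P) * (Y - X)) = 0" if "dist Q X = dist Q Y" "dist P X = dist P Y" for X Y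
  proof -
    have "(dist Q X)\<^sup>2 = (dist Q Y)\<^sup>2" "(dist P X)\<^sup>2 = (dist P Y)\<^sup>2" using that by simp_all
    then show ?thesis
      unfolding dist_complex_def cmod_power2 by (simp add: power2_eq_square algebra_simps)
  qed
  have ab: "Re (cnj (Q - P) * (B - A)) = 0" "Re (cnj (Q - P) * (C - A)) = 0"
    by (rule *; use Q assms in simp)+
  \<comment> \<open>Cramer's rule: a vector recovered from its inner products with the two
    sides.\<close>
  have "(Q - P) * signed_area2 A B C = 
      \<i> * ((B - A) * Re (cnj (Q - P) * (C - A)) - (C - A) * Re (cnj (Q - P) * (B - A)))"
    by (rule complex_eqI) (simp_all add: signed_area2_def algebra_simps)
  then show "Q = P" unfolding ab using assms(1) by simp
qed (use assms in simp)

section \<open>Equal angles and Brocard points\<close>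

lemma angle_eq_arccos_sgn:
  "angle P Q R = arccos (Re (sgn (cnj (R - Q) * (P - Q))))"
proof -
  have "(P - Q) \<bullet> (R - Q) = Re (cnj (R - Q) * (P - Q))"
    by (simp add: inner_complex_def algebra_simps)
  then show ?thesis
    unfolding angle_def Re_sgn norm_mult complex_mod_cnj by (simp only: mult.commute)
qed

lemma angle_eq_iff:
  "angle P Q R = angle P' Q' R' \<longleftrightarrow>
     Re (sgn (cnj (R - Q) * (P - Q))) = Re (sgn (cnj (R' - Q') * (P' - Q')))"
proof -
  have "\<bar>Re (sgn z)\<bar> \<le> 1" for z :: complex
    using abs_Re_le_cmod[of "sgn z"] by (simp add: norm_sgn split: if_splits)
  then show ?thesis
    unfolding angle_eq_arccos_sgn by (intro arccos_eq_iff) blast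
qed

text \<open>Equal cosines and sines of the same sign force equal directions. The conclusion is the
  equality of cotangents, cross-multiplied.\<close>

lemma Re_sgn_eq_imp_cross_eq:
  assumes "Im x * Im y > 0" "Re (sgn x) = Re (sgn y)"
  shows "Re x * Im y = Re y * Im x"
proof -
  have nz: "x \<noteq> 0" "y \<noteq> 0" using assms(1) by auto
  have "(Re (sgn x))\<^sup>2 + (Im (sgn x))\<^sup>2 = 1" "(Re (sgn y))\<^sup>2 + (Im (sgn y))\<^sup>2 = 1"
    using nz by (simp_all only: cmod_power2[symmetric] norm_sgn) simp_all
  then have "(Im (sgn x))\<^sup>2 = (Im (sgn y))\<^sup>2" using assms(2) by simp
  moreover have "Im (sgn x) * Im (sgn y) > 0"
    using assms(1) nz by simp
  ultimately have "Im (sgn x) = Im (sgn y)"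
    by (metis mult_minus_left neg_0_less_iff_less not_square_less_zero power2_eq_iff)
  then have "sgn x = sgn y" using assms(2) by (simp add: complex_eq_iff)
  then have "x = (cmod x / cmod y) *\<^sub>R y"
    using nz by (simp add: sgn_eq field_simps scaleR_conv_of_real)
  then obtain t where "x = t *\<^sub>R y" by blast
  then show ?thesis by simp
qed

text \<open>Adding up the three sides shows that the cotangent of the common angle depends on the
  triangle only; given this cotangent, the position of \<open>P\<close> is determined by linear equations.\<close>

lemma equal_cotangents_unique:
  assumes S: "signed_area2 A B C \<noteq> 0"
    and P: "Re (cnj (B - A) * (P - A)) = k * Im (cnj (B - A) * (P - A))"
      "Re (cnj (C - B) * (P - B)) = k * Im (cnj (C - B) * (P - B))"
      "Re (cnj (A - C) * (P - C)) = k * Im (cnj (A - C) * (P - C))"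
    and Q: "Re (cnj (B - A) * (Q - A)) = l * Im (cnj (B - A) * (Q - A))"
      "Re (cnj (C - B) * (Q - B)) = l * Im (cnj (C - B) * (Q - B))"
      "Re (cnj (A - C) * (Q - C)) = l * Im (cnj (A - C) * (Q - C))"
  shows "P = Q"
proof -
  have Im_sum: "Im (cnj (B - A) * (X - A)) + Im (cnj (C - B) * (X - B)) + Im (cnj (A - C) * (X - C))
      = signed_area2 A B C" for X
    by (simp add: signed_area2_def algebra_simps)
  have Re_sum: "Re (cnj (B - A) * (X - A)) + Re (cnj (C - B) * (X - B)) + Re (cnj (A - C) * (X - C))
      = Re (cnj (B - A) * (Y - A)) + Re (cnj (C - B) * (Y - B)) + Re (cnj (A - C) * (Y - C))" for X Y
    by (simp add: algebra_simps)
  have "k * signed_area2 A B C = l * signed_area2 A B C"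
    using Re_sum[of P Q] unfolding P Q
    unfolding Im_sum[of P, symmetric] by (simp only: distrib_left[symmetric] Im_sum)
  then have "l = k" using S by simp
  define d where "d = P - Q"
  have d1: "Re (cnj (B - A) * d) = k * Im (cnj (B - A) * d)"
    using P(1) Q(1) \<open>l = k\<close> by (simp add: d_def algebra_simps)
  have d2: "Re (cnj (C - B) * d) = k * Im (cnj (C - B) * d)"
    using P(2) Q(2) \<open>l = k\<close> by (simp add: d_def algebra_simps)
  \<comment> \<open>The right side is the imaginary part of \<open>cnj y * x\<close> for
    \<open>x = cnj (B - A) * d\<close> and \<open>y = cnj (C - B) * d\<close>. By \<open>d1\<close>
    and \<open>d2\<close> both are real multiples of one number, so it vanishes.\<close>
  have "(cmod d)\<^sup>2 * signed_area2 A B C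
      = Im (cnj (cnj (C - B) * d)) * Re (cnj (B - A) * d) + Re (cnj (C - B) * d) * Im (cnj (B - A) * d)"
    unfolding cmod_power2 signed_area2_def by (simp add: power2_eq_square algebra_simps)
  also have "\<dots> = 0" unfolding complex_cnj d1 d2 by (simp add: algebra_simps)
  finally show "P = Q" using S by (simp add: d_def)
qed

text \<open>At each vertex, the direction to \<open>P\<close> is the next side turned by the
  argument of the same \<open>z\<close>, so the three angles agree. The three partial areas all have
  the sign of \<open>Im z\<close>, which puts \<open>P\<close> inside whatever the
  orientation.\<close>

lemma brocard_point1_eqI:
  assumes S: "signed_area2 A B C \<noteq> 0"
    and pos: "r1 > 0" "r2 > 0" "r3 > 0" and z: "Im z \<noteq> 0"
    and P: "P - A = of_real r1 * z * (B - A)" "P - B = of_real r2 * z * (C - B)"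
      "P - C = of_real r3 * z * (A - C)"
  shows "brocard_point1 (A, B, C) = P"
proof -
  let ?good = "\<lambda>P. P \<in> interior (convex hull {A, B, C}) \<and>
        angle P A B = angle P B C \<and> angle P B C = angle P C A"
  \<comment> \<open>Every solution inside the triangle satisfies the linear cotangent equations, so
    their uniqueness result applies to it and to \<open>P\<close> alike.\<close>
  have cot: "\<exists>k. Re (cnj (B - A) * (Q - A)) = k * Im (cnj (B - A) * (Q - A)) \<and>
      Re (cnj (C - B) * (Q - B)) = k * Im (cnj (C - B) * (Q - B)) \<and>
      Re (cnj (A - C) * (Q - C)) = k * Im (cnj (A - C) * (Q - C))"
    if "?good Q" for Q
  proof -
    define a b c where "a = cnj (B - A) * (Q - A)" and "b = cnj (C - B) * (Q - B)"
      and "c = cnj (A - C) * (Q - C)"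
    define D where "D = signed_area2 A B C"
    have "Im a / D > 0" "Im b / D > 0" "Im c / D > 0"
      using that interior_triangle_signed_area2[OF S, of Q]
      by (auto simp: a_def b_def c_def signed_area2_def D_def)
    then have "Im a * Im b > 0" "Im b * Im c > 0" and nz: "Im a \<noteq> 0" "Im b \<noteq> 0"
      by (auto simp: zero_less_divide_iff zero_less_mult_iff)
    moreover have "Re (sgn a) = Re (sgn b)" "Re (sgn b) = Re (sgn c)"
      using that unfolding a_def b_def c_def angle_eq_iff by auto
    ultimately have "Re a * Im b = Re b * Im a" "Re b * Im c = Re c * Im b"
      using Re_sgn_eq_imp_cross_eq by blast+
    then have "Re a = Re b / Im b * Im a" "Re b = Re b / Im b * Im b" "Re c = Re b / Im b * Im c"
      using nz by (auto simp: field_simps)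
    then show ?thesis unfolding a_def b_def c_def by blast
  qed
  have area: "signed_area2 X Y P = r * (Im z * (cmod (Y - X))\<^sup>2)"
    and cos: "Re (sgn (cnj (Y - X) * (P - X))) = Re (sgn z)"
    if "P - X = of_real r * z * (Y - X)" "r > 0" "X \<noteq> Y" for X Y r
  proof -
    have *: "cnj (Y - X) * (P - X) = of_real (r * (cmod (Y - X))\<^sup>2) * z"
      unfolding that of_real_mult complex_norm_square by simp
    show "signed_area2 X Y P = r * (Im z * (cmod (Y - X))\<^sup>2)"
      unfolding signed_area2_def * by simp
    have "sgn (of_real (r * (cmod (Y - X))\<^sup>2) * z) = sgn z"
      unfolding sgn_mult sgn_of_real using that by simp
    then show "Re (sgn (cnj (Y - X) * (P - X))) = Re (sgn z)"
      unfolding * by simp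
  qed
  have ne: "A \<noteq> B" "B \<noteq> C" "C \<noteq> A" using S by (auto simp: signed_area2_def algebra_simps)
  have sum: "signed_area2 A B C = Im z * (r1 * (cmod (B - A))\<^sup>2 + r2 * (cmod (C - B))\<^sup>2 + r3 * (cmod (A - C))\<^sup>2)"
  proof -
    have "signed_area2 A B C = signed_area2 A B P + signed_area2 B C P + signed_area2 C A P"
      by (simp add: signed_area2_def algebra_simps)
    then show ?thesis
      unfolding area[OF P(1) pos(1) ne(1)] area[OF P(2) pos(2) ne(2)] area[OF P(3) pos(3) ne(3)]
      by (simp add: algebra_simps)
  qed
  have "r1 * (cmod (B - A))\<^sup>2 + r2 * (cmod (C - B))\<^sup>2 + r3 * (cmod (A - C))\<^sup>2 > 0"
    using pos ne by (intro add_pos_pos mult_pos_pos) auto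
  then have "P \<in> interior (convex hull {A, B, C})"
    unfolding interior_triangle_signed_area2[OF S] sum
      area[OF P(1) pos(1) ne(1)] area[OF P(2) pos(2) ne(2)] area[OF P(3) pos(3) ne(3)]
    using pos ne z by (simp add: zero_less_divide_iff zero_less_mult_iff)
  then have good: "?good P"
    unfolding angle_eq_iff cos[OF P(1) pos(1) ne(1)] cos[OF P(2) pos(2) ne(2)] cos[OF P(3) pos(3) ne(3)]
    by simp
  show ?thesis
    unfolding brocard_point1.simps
  proof (rule the_equality)
    show "Q = P" if "?good Q" for Q
      using cot[OF that] cot[OF good] equal_cotangents_unique[OF S] by blast
  qed (rule good)
qed

text \<open>Exchanging \<open>B\<close> and \<open>C\<close> turns one system of angle equations
  into the other.\<close>

lemma brocard_point2_eq_brocard_point1: "brocard_point2 (A, B, C) = brocard_point1 (A, C, B)"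
  unfolding brocard_point1.simps brocard_point2.simps
  by (rule arg_cong[of _ _ The]) (auto simp: insert_commute)

section \<open>Symmedians and the symmedian point\<close>

text \<open>With \<open>b = B - A\<close> and \<open>c = C - A\<close>, the reflected median has
  direction \<open>sgn b * sgn c * cnj (b + c)\<close>, a positive multiple of
  \<open>cnj (1 / b + 1 / c)\<close>. The latter has no square roots, which suits rational
  coordinates.\<close>

lemma mem_symmedian_iff:
  assumes "signed_area2 A B C \<noteq> 0"
  shows "P \<in> symmedian A B C \<longleftrightarrow>
    (\<exists>t. P = A + t *\<^sub>R cnj (1 / (B - A) + 1 / (C - A)))"
proof -
  define b c where "b = B - A" and "c = C - A"
  have nz: "b \<noteq> 0" "c \<noteq> 0" "sgn b + sgn c \<noteq> 0"
  proof -
    show bc: "b \<noteq> 0" "c \<noteq> 0" using assms by (auto simp: signed_area2_def b_def c_def)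
    show "sgn b + sgn c \<noteq> 0"
    proof
      assume "sgn b + sgn c = 0"
      then have "b = - (cmod b / cmod c) *\<^sub>R c"
        using bc by (simp add: sgn_eq field_simps scaleR_conv_of_real eq_neg_iff_add_eq_0)
      then obtain t where "b = t *\<^sub>R c" by blast
      then have "Im (cnj b * c) = 0" by simp
      then show False using assms by (simp add: signed_area2_def b_def c_def)
    qed
  qed
  have unit: "sgn z * cnj (sgn z) = 1" if "z \<noteq> 0" for z :: complex
    using that by (metis complex_norm_square norm_sgn of_real_1 one_power2)
  \<comment> \<open>The conjugate of a unit number is its inverse, so the bisector direction divided
    by its conjugate is the product of the two unit vectors.\<close>
  have "(sgn b + sgn c) = sgn b * sgn c * cnj (sgn b + sgn c)"
    using unit[OF nz(1)] unit[OF nz(2)] by (simp add: algebra_simps)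
  then have refl: "(sgn b + sgn c) / cnj (sgn b + sgn c) = sgn b * sgn c"
    using nz(3) by (metis complex_cnj_zero_iff nonzero_eq_divide_eq)
  define e where "e = cnj (1 / b + 1 / c)"
  have "b * c * cnj (b + c) = of_real ((cmod b)\<^sup>2 * (cmod c)\<^sup>2) * e"
    unfolding of_real_mult complex_norm_square e_def using nz by (simp add: field_simps)
  then have "sgn b * sgn c * cnj ((b + c) / 2) = (cmod b * cmod c / 2) *\<^sub>R e"
    using nz by (simp add: sgn_eq field_simps scaleR_conv_of_real power2_eq_square)
  moreover have "midpoint B C - A = (b + c) / 2"
    by (simp add: midpoint_def b_def c_def scaleR_conv_of_real field_simps)
  ultimately have "reflect_in_line A (sgn b + sgn c) (midpoint B C) - A = (cmod b * cmod c / 2) *\<^sub>R e"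
    unfolding reflect_in_line_def refl by (simp only: add_diff_cancel_left')
  then have "symmedian A B C = range (\<lambda>u. A + u *\<^sub>R ((cmod b * cmod c / 2) *\<^sub>R e))"
    unfolding symmedian_def affine_hull_2_alt b_def c_def by simp
  moreover have "range (\<lambda>u. A + u *\<^sub>R (k *\<^sub>R e)) = range (\<lambda>u. A + u *\<^sub>R e)" if "k \<noteq> 0" for k
  proof -
    have "A + u *\<^sub>R e \<in> range (\<lambda>u. A + u *\<^sub>R (k *\<^sub>R e))" for u
      by (rule range_eqI[of _ _ "u / k"]) (use that in simp)
    then show ?thesis by auto
  qed
  moreover have "cmod b * cmod c / 2 \<noteq> 0" using nz by simp
  ultimately have "symmedian A B C = range (\<lambda>u. A + u *\<^sub>R e)" by metis
  then show ?thesis by (auto simp: e_def b_def c_def)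
qed

text \<open>A point on the symmedians from \<open>A\<close> and \<open>B\<close> differs from
  \<open>K\<close> by a multiple of \<open>K - A\<close> and by a multiple of \<open>K - B\<close>;
  by \<open>cross\<close> these are independent.\<close>

lemma symmedian_point_eqI:
  assumes S: "signed_area2 A B C \<noteq> 0" and t: "t1 \<noteq> 0" "t2 \<noteq> 0"
    and K: "K = A + t1 *\<^sub>R cnj (1 / (B - A) + 1 / (C - A))"
      "K = B + t2 *\<^sub>R cnj (1 / (C - B) + 1 / (A - B))"
      "K = C + t3 *\<^sub>R cnj (1 / (A - C) + 1 / (B - C))"
  shows "symmedian_point (A, B, C) = K"
proof -
  have S2: "signed_area2 B C A \<noteq> 0" and S3: "signed_area2 C A B \<noteq> 0"
    using S by (simp_all add: signed_area2_rotate)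
  define b c where "b = B - A" and "c = C - A"
  have nz: "b \<noteq> 0" "c \<noteq> 0" using S by (auto simp: signed_area2_def b_def c_def)
  have cross: "Im (cnj (K - A) * (K - B)) \<noteq> 0"
  proof -
    have "K - A = t1 *\<^sub>R cnj (1 / b + 1 / c)"
      using K(1) by (simp add: b_def c_def)
    then have e: "cnj (K - A) = t1 *\<^sub>R (1 / b + 1 / c)"
      by simp
    have "Im (cnj (K - A) * (K - B)) = - Im (cnj (K - A) * b)"
      unfolding b_def by (simp add: algebra_simps)
    also have "\<dots> = - (t1 * Im (b / c))"
      unfolding e using nz by (simp add: distrib_right)
    also have "b / c = b * cnj c / of_real ((cmod c)\<^sup>2)"
      unfolding complex_norm_square using nz by simp
    also have "Im \<dots> = - signed_area2 A B C / (cmod c)\<^sup>2"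
      unfolding Im_divide_of_real signed_area2_def b_def c_def by (simp add: algebra_simps)
    finally show ?thesis using S t nz by simp
  qed
  show ?thesis
    unfolding symmedian_point.simps mem_symmedian_iff[OF S] mem_symmedian_iff[OF S2]
      mem_symmedian_iff[OF S3]
  proof (rule the_equality)
    fix P
    let ?d = "cnj (1 / (B - A) + 1 / (C - A))" and ?e = "cnj (1 / (C - B) + 1 / (A - B))"
    assume "(\<exists>t. P = A + t *\<^sub>R ?d) \<and> (\<exists>t. P = B + t *\<^sub>R ?e) \<and>
      (\<exists>t. P = C + t *\<^sub>R cnj (1 / (A - C) + 1 / (B - C)))"
    then obtain s s' where "P = A + s *\<^sub>R ?d" "P = B + s' *\<^sub>R ?e"
      by blast
    moreover have "K - A = t1 *\<^sub>R ?d" "K - B = t2 *\<^sub>R ?e"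
      using K(1,2) by (metis add_diff_cancel_left')+
    then have "?d = (1 / t1) *\<^sub>R (K - A)" "?e = (1 / t2) *\<^sub>R (K - B)"
      using t by (simp_all only: scaleR_scaleR) simp_all
    ultimately have P1: "P = A + (s / t1) *\<^sub>R (K - A)" and P2: "P = B + (s' / t2) *\<^sub>R (K - B)"
      by simp_all
    have "P - K = (s / t1 - 1) *\<^sub>R (K - A)" unfolding P1 by (simp add: algebra_simps)
    moreover have "P - K = (s' / t2 - 1) *\<^sub>R (K - B)" unfolding P2 by (simp add: algebra_simps)
    ultimately have eq: "(s / t1 - 1) *\<^sub>R (K - A) = (s' / t2 - 1) *\<^sub>R (K - B)" and
        PK: "P - K = (s' / t2 - 1) *\<^sub>R (K - B)" by simp_all
    have "(s' / t2 - 1) * Im (cnj (K - A) * (K - B)) = Im (cnj (K - A) * ((s' / t2 - 1) *\<^sub>R (K - B)))"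
      by (simp add: algebra_simps)
    also have "\<dots> = 0" unfolding eq[symmetric] by (simp add: algebra_simps)
    finally have "s' / t2 - 1 = 0" using cross by simp
    then show "P = K" using PK by simp
  qed (use K in blast)
qed

text \<open>Along the line, the equation of the circle is quadratic in the parameter with roots
  \<open>0\<close> and \<open>t\<close>; the double root \<open>t = 0\<close> is the tangent
  case.\<close>

lemma second_intersection_eqI:
  assumes "A \<noteq> S" and S: "S \<in> sphere Z r"
    and t: "2 * ((S - Z) \<bullet> (A - S)) + t * (norm (A - S))\<^sup>2 = 0"
  shows "second_intersection A S (sphere Z r) = S + t *\<^sub>R (A - S)"
proof -
  have on_line: "S + s *\<^sub>R (A - S) \<in> sphere Z r \<longleftrightarrow> s = 0 \<or> s = t" for s
  proof -
    have r: "r \<ge> 0" "(norm (S - Z))\<^sup>2 = r\<^sup>2" using S by (auto simp: dist_norm norm_minus_commute)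
    have "S + s *\<^sub>R (A - S) \<in> sphere Z r \<longleftrightarrow> (norm ((S - Z) + s *\<^sub>R (A - S)))\<^sup>2 = r\<^sup>2"
      using r(1) by (simp add: dist_norm norm_minus_commute algebra_simps)
    also have "(norm ((S - Z) + s *\<^sub>R (A - S)))\<^sup>2
        = r\<^sup>2 + s * (2 * ((S - Z) \<bullet> (A - S)) + s * (norm (A - S))\<^sup>2)"
      unfolding r(2)[symmetric] power2_norm_eq_inner
      by (simp add: inner_commute algebra_simps)
    also have "2 * ((S - Z) \<bullet> (A - S)) = - t * (norm (A - S))\<^sup>2" using t by simp
    also have "s * (- t * (norm (A - S))\<^sup>2 + s * (norm (A - S))\<^sup>2) = s * (s - t) * (norm (A - S))\<^sup>2"
      by (simp add: algebra_simps)
    finally show ?thesis using \<open>A \<noteq> S\<close> by auto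
  qed
  then have int: "affine hull {A, S} \<inter> sphere Z r = {S, S + t *\<^sub>R (A - S)}"
    unfolding insert_commute[of A S] affine_hull_2_alt using on_line S by (auto simp del: mem_sphere)
  show ?thesis
  proof (cases "t = 0")
    case False
    then have "S + t *\<^sub>R (A - S) \<noteq> S" using \<open>A \<noteq> S\<close> by simp
    then show ?thesis unfolding second_intersection_def int
      by auto
  qed (simp add: second_intersection_def int)
qed

subsection \<open>Triangles in isodynamic coordinates\<close>

text \<open>The inverse of the coordinate map. The coordinate \<open>1\<close> stands for the point
  at infinity and must be avoided; the isodynamic points are \<open>p - q\<close> and
  \<open>p\<close>.\<close>

definition mobius_point :: "complex \<Rightarrow> complex \<Rightarrow> complex \<Rightarrow> complex" where
  "mobius_point p q x = p + q / (x - 1)"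

definition mobius_triangle :: "complex \<Rightarrow> complex \<Rightarrow> complex \<Rightarrow> complex \<Rightarrow> triangle" where
  "mobius_triangle p q w u = (mobius_point p q u, mobius_point p q (w * u), mobius_point p q (w\<^sup>2 * u))"

lemma mobius_point_diff:
  assumes "x \<noteq> 1" "y \<noteq> 1"
  shows "mobius_point p q x - mobius_point p q y = q * (y - x) / ((x - 1) * (y - 1))"
  using assms by (simp add: mobius_point_def divide_simps) (simp add: algebra_simps)

lemma dist_mobius_point:
  assumes "x \<noteq> 1" "y \<noteq> 1"
  shows "dist (mobius_point p q x) (mobius_point p q y) = cmod q * cmod (y - x) / (cmod (x - 1) * cmod (y - 1))"
  unfolding dist_norm mobius_point_diff[OF assms] by (simp add: norm_mult norm_divide)

text \<open>Moebius maps preserve inversion, and the center of a circle is the inverse of infinity.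
  So a circle around \<open>0\<close> is mapped to the circle whose center has as coordinate the
  inverse of \<open>1\<close>, the squared radius.\<close>

lemma dist_mobius_point_center:
  assumes "cmod x < 1"
  shows "dist (mobius_point p q (of_real ((cmod x)\<^sup>2))) (mobius_point p q x) = cmod q * cmod x / (1 - (cmod x)\<^sup>2)"
proof -
  have r: "(cmod x)\<^sup>2 < 1" using assms by (simp add: power_less_one_iff)
  then have r1: "of_real ((cmod x)\<^sup>2) \<noteq> (1::complex)" by (metis less_irrefl of_real_eq_1_iff)
  have x1: "x \<noteq> 1" using assms by auto
  have "x - of_real ((cmod x)\<^sup>2) = x * cnj (1 - x)" unfolding complex_norm_square by (simp add: algebra_simps)
  then have n: "cmod (x - of_real ((cmod x)\<^sup>2)) = cmod x * cmod (x - 1)"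
    by (simp only: norm_mult complex_mod_cnj norm_minus_commute)
  have "of_real ((cmod x)\<^sup>2) - 1 = (of_real ((cmod x)\<^sup>2 - 1) :: complex)" by simp
  then have m: "cmod (of_real ((cmod x)\<^sup>2) - 1) = 1 - (cmod x)\<^sup>2"
    using r by (simp only: norm_of_real) 
  show ?thesis unfolding dist_mobius_point[OF r1 x1] n m using x1 by simp
qed

lemma cube_root_unity:
  fixes w :: complex
  assumes "w\<^sup>2 + w + 1 = 0"
  shows "Re w = - 1 / 2" "(Im w)\<^sup>2 = 3 / 4" "cnj w = w\<^sup>2" "w * w\<^sup>2 = 1"
proof -
  have re: "(Re w)\<^sup>2 - (Im w)\<^sup>2 + Re w + 1 = 0" and im: "Im w * (2 * Re w + 1) = 0"
    using arg_cong[OF assms, of Re] arg_cong[OF assms, of Im]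
    by (simp_all add: power2_eq_square algebra_simps)
  have "Im w \<noteq> 0"
  proof
    assume "Im w = 0"
    then have "(Re w + 1 / 2)\<^sup>2 + 3 / 4 = 0" using re by (simp add: power2_eq_square algebra_simps)
    moreover have "(Re w + 1 / 2)\<^sup>2 \<ge> 0" by simp
    ultimately show False by linarith
  qed
  then show r: "Re w = - 1 / 2" using im by simp
  show i: "(Im w)\<^sup>2 = 3 / 4" using re unfolding r by (simp add: power2_eq_square)
  then show "cnj w = w\<^sup>2" using r by (simp add: complex_eq_iff power2_eq_square)
  show "w * w\<^sup>2 = 1" using assms by algebra
qed

text \<open>The isodynamic points are the images of \<open>0\<close> and \<open>\<infinity>\<close>. The primitive cube root of unity
  \<open>w\<close> encodes the orientation of the triangle: passing to \<open>w\<^sup>2\<close> exchanges the last two vertices.\<close>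

locale mobius_frame =
  fixes p q w u :: complex
  assumes q: "q \<noteq> 0" and w: "w\<^sup>2 + w + 1 = 0" and u: "u \<noteq> 0" "cmod u < 1"
begin

definition r where "r = (cmod u)\<^sup>2"

abbreviation "pt \<equiv> mobius_point p q"

lemma w_simps: "cnj w = w\<^sup>2" "cnj (w\<^sup>2) = w" "w * w\<^sup>2 = 1" "w ^ 4 = w" "cmod w = 1" "Im w \<noteq> 0" "w \<noteq> 1" "w \<noteq> 0" "w\<^sup>2 \<noteq> 1"
proof -
  show 1: "cnj w = w\<^sup>2" "w * w\<^sup>2 = 1" using cube_root_unity[OF w] by auto
  show "cnj (w\<^sup>2) = w" using 1 by (metis complex_cnj_cnj)
  show "w ^ 4 = w" using w by algebra
  show "Im w \<noteq> 0" using cube_root_unity(2)[OF w] by auto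
  then show 2: "w \<noteq> 1" by auto
  show "w \<noteq> 0" using 1 by auto
  show "w\<^sup>2 \<noteq> 1" using 1 2 by auto
  have "w * cnj w = 1" using 1 by simp
  then show "cmod w = 1" by (metis complex_mod_mult_cnj norm_one power2_eq_1_iff norm_ge_zero abs_norm_cancel real_sqrt_abs real_sqrt_one)
qed

lemma r: "r > 0" "r < 1"
  using u unfolding r_def by (auto simp: power_less_one_iff)

lemma of_real_r: "of_real r = u * cnj u"
  unfolding r_def by (rule complex_norm_square)

lemma neq_1: "cmod x < 1 \<Longrightarrow> x \<noteq> 1" for x :: complex
  by auto

lemma ne: "u \<noteq> 1" "w * u \<noteq> 1" "w\<^sup>2 * u \<noteq> 1" "of_real r \<noteq> (1::complex)" "w * of_real r \<noteq> 1" "w\<^sup>2 * of_real r \<noteq> 1"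
    "- of_real r \<noteq> (1::complex)" "u\<^sup>2 \<noteq> 1" "(of_real r)\<^sup>2 \<noteq> (1::complex)"
  using u r w_simps(5)
  by (auto intro!: neq_1 simp: norm_mult norm_power power_less_one_iff r_def[symmetric])

text \<open>Replacing \<open>u\<close> by \<open>w * u\<close> relabels the vertices cyclically, so
  vertex formulas need a proof at the vertex \<open>u\<close> only.\<close>

lemma rotate: "mobius_frame q w (w * u)"
  using q w u w_simps by unfold_locales (auto simp: norm_mult)

lemma rotate_r: "mobius_frame.r (w * u) = r"
  unfolding mobius_frame.r_def[OF rotate] r_def by (simp add: norm_mult w_simps)

lemma swap: "mobius_frame q (w\<^sup>2) u"
proof unfold_locales
  show "(w\<^sup>2)\<^sup>2 + w\<^sup>2 + 1 = 0" using w by algebra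
qed (use q u in auto)

lemma square: "mobius_frame q w (u\<^sup>2)"
  using q w u by unfold_locales (auto simp: norm_power power_less_one_iff)

text \<open>The triangle of circumcenter and Brocard points is itself of the same form, with
  \<open>r\<close> for \<open>u\<close> and \<open>w\<^sup>2\<close> for \<open>w\<close>. The
  Brocard circle thus comes from the formulas for circumcircles.\<close>

lemma brocard_circle_frame: "mobius_frame q (w\<^sup>2) (of_real r)"
proof -
  have "(w\<^sup>2)\<^sup>2 + w\<^sup>2 + 1 = 0" using w by algebra
  then show ?thesis using q r by unfold_locales auto
qed

text \<open>Up to a positive factor, the area is \<open>(1 - r) * Im w\<close>.\<close>

lemma signed_area2_neq_0: "signed_area2 (pt u) (pt (w * u)) (pt (w\<^sup>2 * u)) \<noteq> 0"
proof -
  define d where "d = pt (w * u) - pt u"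
  have d: "d = q * (u - w * u) / ((w * u - 1) * (u - 1))"
    unfolding d_def by (rule mobius_point_diff) (rule ne)+
  then have d0: "d \<noteq> 0" using q u ne w_simps by auto
  have "pt (w\<^sup>2 * u) - pt u = q * (u - w\<^sup>2 * u) / ((w\<^sup>2 * u - 1) * (u - 1))"
    by (rule mobius_point_diff) (rule ne)+
  also have "\<dots> = d * ((1 + w) * (w * u - 1) / (w\<^sup>2 * u - 1))"
    unfolding d by (simp add: divide_simps ne q) algebra
  also have "\<dots> = d * ((1 + w) * (w * u - 1) * cnj (w\<^sup>2 * u - 1)) / of_real ((cmod (w\<^sup>2 * u - 1))\<^sup>2)"
  proof -
    have "d * (x / y) = d * (x * cnj y) / of_real ((cmod y)\<^sup>2)" if "y \<noteq> 0" for x y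
      unfolding complex_norm_square using that by simp
    moreover have "w\<^sup>2 * u - 1 \<noteq> 0" using ne(3) by simp
    ultimately show ?thesis by blast
  qed
  also have "(1 + w) * (w * u - 1) * cnj (w\<^sup>2 * u - 1) = - (w * (u * cnj u)) + (u + cnj u) - w\<^sup>2"
    unfolding complex_cnj_diff complex_cnj_mult w_simps complex_cnj_one using w by algebra
  also have "\<dots> = - (w * of_real r) + of_real (2 * Re u) - cnj w"
    by (simp only: of_real_r complex_add_cnj w_simps)
  finally have "cnj d * (pt (w\<^sup>2 * u) - pt u) =
     of_real ((cmod d)\<^sup>2) * (- (w * of_real r) + of_real (2 * Re u) - cnj w) / of_real ((cmod (w\<^sup>2 * u - 1))\<^sup>2)"
    unfolding complex_norm_square by simp
  then have "signed_area2 (pt u) (pt (w * u)) (pt (w\<^sup>2 * u))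
      = (cmod d)\<^sup>2 * ((1 - r) * Im w) / (cmod (w\<^sup>2 * u - 1))\<^sup>2"
    unfolding signed_area2_def d_def[symmetric] by (simp only: Im_divide_of_real) (simp add: algebra_simps)
  then show ?thesis using d0 r w_simps ne by simp
qed

section \<open>The triangle centers and the Brocard circle in coordinates\<close>

lemma dist_circumcenter:
  assumes "cmod x = cmod u"
  shows "dist (pt (of_real r)) (pt x) = cmod q * cmod u / (1 - r)"
  using dist_mobius_point_center[of x p q] assms u by (simp add: r_def)

lemma circumcenter: "circumcenter (mobius_triangle p q w u) = pt (of_real r)"
  unfolding mobius_triangle_def using signed_area2_neq_0
  by (rule circumcenter_eqI) (simp_all add: dist_circumcenter norm_mult norm_power w_simps)

lemma circumradius: "circumradius (mobius_triangle p q w u) = cmod q * cmod u / (1 - r)"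
proof -
  have "circumradius (mobius_triangle p q w u) = dist (circumcenter (mobius_triangle p q w u)) (pt u)"
    by (simp add: mobius_triangle_def)
  then show ?thesis by (simp add: circumcenter dist_circumcenter)
qed

text \<open>The middle factor depends on \<open>u\<close> only through \<open>r\<close>, so it is
  the same at all three vertices, as the criterion for the Brocard point requires.\<close>

lemma brocard_ratio:
  "pt (w\<^sup>2 * of_real r) - pt u =
    of_real ((cmod (1 - w * u))\<^sup>2) * (1 / ((1 - w\<^sup>2 * of_real r) * (1 - w))) * (pt (w * u) - pt u)"
proof -
  define x where "x = w\<^sup>2 * of_real r"
  have x: "x = w\<^sup>2 * u * cnj u" "x \<noteq> 1" using ne by (auto simp: x_def of_real_r)
  have n: "of_real ((cmod (1 - w * u))\<^sup>2) = (1 - w * u) * (1 - w\<^sup>2 * cnj u)"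
    unfolding complex_norm_square by (simp add: w_simps)
  have "q * (u - x) / ((x - 1) * (u - 1)) = (1 - w * u) * (1 - w\<^sup>2 * cnj u) * (1 / ((1 - x) * (1 - w))) *
      (q * (u - w * u) / ((w * u - 1) * (u - 1)))"
    by (simp add: divide_simps ne w_simps q x(2)) (use x(1) in algebra)
  then show ?thesis
    unfolding x_def[symmetric] n mobius_point_diff[OF x(2) ne(1)] mobius_point_diff[OF ne(2) ne(1)] .
qed

lemma brocard_point1: "brocard_point1 (mobius_triangle p q w u) = pt (w\<^sup>2 * of_real r)"
proof -
  interpret B: mobius_frame p q w "w * u" by (rule rotate)
  interpret C: mobius_frame p q w "w * (w * u)" by (rule B.rotate)
  have ww: "w * (w * u) = w\<^sup>2 * u" "w * (w\<^sup>2 * u) = u"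
    using w_simps(3) by (simp_all add: power2_eq_square mult.assoc[symmetric])
  let ?z = "1 / ((1 - w\<^sup>2 * of_real r) * (1 - w))"
  have "(1 - w\<^sup>2 * of_real r) * (1 - w) = 1 - w - cnj w * of_real r + of_real r"
    unfolding w_simps using w by algebra
  then have "Im ((1 - w\<^sup>2 * of_real r) * (1 - w)) = - (1 - r) * Im w"
    by (simp only:) (simp add: algebra_simps)
  then have "Im ((1 - w\<^sup>2 * of_real r) * (1 - w)) \<noteq> 0"
    using w_simps(6) r by simp
  moreover have "Im (1 / y) \<noteq> 0" if "Im y \<noteq> 0" for y
    using that by (auto simp: Im_divide complex_neq_0)
  ultimately have "Im ?z \<noteq> 0" by blast
  then show ?thesis
    unfolding mobius_triangle_def
  proof (rule brocard_point1_eqI[OF signed_area2_neq_0, rotated 3])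
    show "pt (w\<^sup>2 * of_real r) - pt u = of_real ((cmod (1 - w * u))\<^sup>2) * ?z * (pt (w * u) - pt u)"
      by (rule brocard_ratio)
    show "pt (w\<^sup>2 * of_real r) - pt (w * u) = of_real ((cmod (1 - w\<^sup>2 * u))\<^sup>2) * ?z * (pt (w\<^sup>2 * u) - pt (w * u))"
      using B.brocard_ratio unfolding rotate_r ww .
    show "pt (w\<^sup>2 * of_real r) - pt (w\<^sup>2 * u) = of_real ((cmod (1 - u))\<^sup>2) * ?z * (pt u - pt (w\<^sup>2 * u))"
      using C.brocard_ratio unfolding B.rotate_r rotate_r unfolding ww .
  qed (use ne in auto)
qed

lemma brocard_point2: "brocard_point2 (mobius_triangle p q w u) = pt (w * of_real r)"
proof -
  interpret S: mobius_frame p q "w\<^sup>2" u by (rule swap)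
  have "(w\<^sup>2)\<^sup>2 = w" using w_simps by simp
  then show ?thesis
    using S.brocard_point1 unfolding mobius_triangle_def brocard_point2_eq_brocard_point1 by simp
qed

lemma brocard_circle:
  "brocard_circle (mobius_triangle p q w u) = sphere (pt (of_real (r\<^sup>2))) (cmod q * r / (1 - r\<^sup>2))"
proof -
  interpret K: mobius_frame p q "w\<^sup>2" "of_real r" by (rule brocard_circle_frame)
  have "K.r = r\<^sup>2" using r by (simp add: K.r_def)
  moreover have "brocard_circle (mobius_triangle p q w u) = circumcircle (mobius_triangle p q (w\<^sup>2) (of_real r))"
    unfolding brocard_circle_def circumcenter brocard_point1 brocard_point2
    using w_simps by (simp add: mobius_triangle_def)
  ultimately show ?thesis
    using r by (simp add: circumcircle_def K.circumcenter K.circumradius)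
qed

text \<open>The sum of the reciprocal sides collapses to \<open>(1 - u\<^sup>2) / (u * q)\<close>,
  in which \<open>w\<close> has disappeared.\<close>

lemma symmedian_ratio:
  "pt (- of_real r) = pt u +
    ((cmod q)\<^sup>2 * r / ((1 + r) * (cmod (1 - u))\<^sup>2)) *\<^sub>R cnj (1 / (pt (w * u) - pt u) + 1 / (pt (w\<^sup>2 * u) - pt u))"
proof -
  have "1 / (pt (w * u) - pt u) + 1 / (pt (w\<^sup>2 * u) - pt u) =
      1 / (q * (u - w * u) / ((w * u - 1) * (u - 1))) + 1 / (q * (u - w\<^sup>2 * u) / ((w\<^sup>2 * u - 1) * (u - 1)))"
    by (simp only: mobius_point_diff ne not_False_eq_True)
  also have "\<dots> = (1 - u\<^sup>2) / (u * q)"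
  proof -
    have "u - w * u \<noteq> 0" "u - w\<^sup>2 * u \<noteq> 0" using u w_simps by auto
    then show ?thesis by (simp add: divide_simps u q ne) (use w in algebra)
  qed
  finally have e: "1 / (pt (w * u) - pt u) + 1 / (pt (w\<^sup>2 * u) - pt u) = (1 - u\<^sup>2) / (u * q)" .
  have r1: "1 + of_real r \<noteq> (0::complex)" using ne(7) by (metis add.commute eq_neg_iff_add_eq_0)
  have c1: "1 - cnj u \<noteq> 0" using ne by (metis complex_cnj_one complex_cnj_cancel_iff eq_iff_diff_eq_0)
  have "pt (- of_real r) - pt u = q * (u + of_real r) / ((- of_real r - 1) * (u - 1))"
    using mobius_point_diff[OF ne(7) ne(1)] by simp
  also have "\<dots> = (q * cnj q * of_real r / ((1 + of_real r) * ((1 - u) * cnj (1 - u)))) * cnj ((1 - u\<^sup>2) / (u * q))"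
    using r1 c1 u q ne(1,7) unfolding complex_cnj
    by (simp add: divide_simps) (use of_real_r in algebra)
  also have "\<dots> = ((cmod q)\<^sup>2 * r / ((1 + r) * (cmod (1 - u))\<^sup>2)) *\<^sub>R cnj ((1 - u\<^sup>2) / (u * q))"
    unfolding scaleR_conv_of_real of_real_mult of_real_divide of_real_add of_real_1 complex_norm_square ..
  finally show ?thesis unfolding e by (simp add: algebra_simps)
qed

lemma symmedian_point: "symmedian_point (mobius_triangle p q w u) = pt (- of_real r)"
proof -
  interpret B: mobius_frame p q w "w * u" by (rule rotate)
  interpret C: mobius_frame p q w "w * (w * u)" by (rule B.rotate)
  have ww: "w * (w * u) = w\<^sup>2 * u" "w * (w\<^sup>2 * u) = u" "w\<^sup>2 * (w * u) = u" "w\<^sup>2 * (w\<^sup>2 * u) = w * u"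
    using w_simps(3) by (simp_all add: power2_eq_square mult.assoc[symmetric])
  show ?thesis
    unfolding mobius_triangle_def
  proof (rule symmedian_point_eqI[OF signed_area2_neq_0])
    show "pt (- of_real r) = pt u + ((cmod q)\<^sup>2 * r / ((1 + r) * (cmod (1 - u))\<^sup>2)) *\<^sub>R
        cnj (1 / (pt (w * u) - pt u) + 1 / (pt (w\<^sup>2 * u) - pt u))"
      by (rule symmedian_ratio)
    show "pt (- of_real r) = pt (w * u) + ((cmod q)\<^sup>2 * r / ((1 + r) * (cmod (1 - w * u))\<^sup>2)) *\<^sub>R
        cnj (1 / (pt (w\<^sup>2 * u) - pt (w * u)) + 1 / (pt u - pt (w * u)))"
      using B.symmedian_ratio unfolding rotate_r ww .
    show "pt (- of_real r) = pt (w\<^sup>2 * u) + ((cmod q)\<^sup>2 * r / ((1 + r) * (cmod (1 - w\<^sup>2 * u))\<^sup>2)) *\<^sub>R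
        cnj (1 / (pt u - pt (w\<^sup>2 * u)) + 1 / (pt (w * u) - pt (w\<^sup>2 * u)))"
      using C.symmedian_ratio unfolding B.rotate_r rotate_r unfolding ww .
  qed (use q r ne in auto)
qed

section \<open>The second Brocard triangle and its iterates\<close>

lemma second_intersection_vertex:
  "second_intersection (pt u) (pt (- of_real r)) (sphere (pt (of_real (r\<^sup>2))) (cmod q * r / (1 - r\<^sup>2))) = pt (u\<^sup>2)"
proof -
  \<comment> \<open>The quotient of \<open>pt (u\<^sup>2) - pt (- of_real r)\<close> by
    \<open>pt u - pt (- of_real r)\<close>, which is real. It is \<open>0\<close> for purely
    imaginary \<open>u\<close>, the tangent case, where \<open>u\<^sup>2\<close> is
    \<open>- r\<close>.\<close>
  define t where "t = 2 * Re u / (cmod (u + 1))\<^sup>2"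
  have u1: "u + 1 \<noteq> 0" using u by (auto simp: add_eq_0_iff2)
  have c1: "cnj u + 1 \<noteq> 0" using u1 by (metis complex_cnj_add complex_cnj_one complex_cnj_zero_iff)
  have r1: "1 + of_real r \<noteq> (0::complex)" using ne(7) by (metis add.commute eq_neg_iff_add_eq_0)
  have AS: "pt u - pt (- of_real r) = q * (u + of_real r) / ((u - 1) * (1 + of_real r))"
    unfolding mobius_point_diff[OF ne(1) ne(7)] using ne(1) r1 by (simp add: divide_simps) algebra
  have SZ: "pt (- of_real r) - pt ((of_real r)\<^sup>2) = q * of_real (r / (1 - r\<^sup>2))"
    unfolding mobius_point_diff[OF ne(7) ne(9)] using ne(7,9) r1 by (simp add: divide_simps) algebra
  have ur: "u + of_real r = u * cnj (u + 1)" by (simp add: of_real_r algebra_simps)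
  have "pt u \<noteq> pt (- of_real r)" using AS q u u1 c1 r1 ne(1) unfolding ur by auto
  moreover have "pt (- of_real r) \<in> sphere (pt (of_real (r\<^sup>2))) (cmod q * r / (1 - r\<^sup>2))"
    using dist_mobius_point_center[of "- of_real r" p q] r by simp
  moreover have "2 * ((pt (- of_real r) - pt (of_real (r\<^sup>2))) \<bullet> (pt u - pt (- of_real r))) +
      t * (norm (pt u - pt (- of_real r)))\<^sup>2 = 0"
  proof -
    have N: "(norm (pt u - pt (- of_real r)))\<^sup>2 = (cmod q)\<^sup>2 * (r * (cmod (u + 1))\<^sup>2) / ((cmod (u - 1))\<^sup>2 * (1 + r)\<^sup>2)"
    proof -
      have "cmod (1 + of_real r) = 1 + r" using r by (metis abs_of_pos add_pos_pos norm_of_real of_real_1 of_real_add zero_less_one)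
      then show ?thesis unfolding AS ur norm_mult norm_divide complex_mod_cnj
        by (simp add: power_mult_distrib power_divide r_def)
    qed
    have "(u + of_real r) / (u - 1) = (u + of_real r) * cnj (u - 1) / of_real ((cmod (u - 1))\<^sup>2)"
      unfolding complex_norm_square using ne(1) by simp
    also have "Re \<dots> = - (1 - r) * Re u / (cmod (u - 1))\<^sup>2"
    proof -
      have "r = Re u * Re u + Im u * Im u" unfolding r_def cmod_power2 by (simp add: power2_eq_square)
      then show ?thesis unfolding Re_divide_of_real by (simp add: algebra_simps)
    qed
    finally have R: "Re ((u + of_real r) / (u - 1)) = - (1 - r) * Re u / (cmod (u - 1))\<^sup>2" .
    \<comment> \<open>By \<open>SZ\<close>, the radius to the symmedian point is a real multiple of
      \<open>q\<close>, so the inner product reduces to the real part of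
      \<open>(u + r) / (u - 1)\<close>.\<close>
    have "(pt (- of_real r) - pt (of_real (r\<^sup>2))) \<bullet> (pt u - pt (- of_real r))
      = Re (cnj (pt (- of_real r) - pt ((of_real r)\<^sup>2)) * (pt u - pt (- of_real r)))"
      by (simp add: inner_complex_def algebra_simps)
    also have "cnj (pt (- of_real r) - pt ((of_real r)\<^sup>2)) * (pt u - pt (- of_real r)) =
        of_real ((cmod q)\<^sup>2 * (r / (1 - r\<^sup>2)) / (1 + r)) * ((u + of_real r) / (u - 1))"
      unfolding AS SZ by (simp add: complex_norm_square[unfolded of_real_power] mult_ac)
    also have "Re \<dots> = (cmod q)\<^sup>2 * (r / (1 - r\<^sup>2)) / (1 + r) * (- (1 - r) * Re u / (cmod (u - 1))\<^sup>2)"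
      by (simp only: Re_complex_of_real times_complex.simps R Im_complex_of_real)
    also have "\<dots> = - ((cmod q)\<^sup>2 * r * Re u / ((1 + r)\<^sup>2 * (cmod (u - 1))\<^sup>2))"
    proof -
      have "1 - r\<^sup>2 = (1 - r) * (1 + r)" by (simp add: power2_eq_square algebra_simps)
      moreover have "1 - r \<noteq> 0" "1 + r \<noteq> 0" "cmod (u - 1) \<noteq> 0" using r ne(1) by auto
      ultimately show ?thesis
        by (simp add: divide_simps power2_eq_square) (simp add: algebra_simps)
    qed
    finally have I: "(pt (- of_real r) - pt (of_real (r\<^sup>2))) \<bullet> (pt u - pt (- of_real r))
      = - ((cmod q)\<^sup>2 * r * Re u / ((1 + r)\<^sup>2 * (cmod (u - 1))\<^sup>2))" .
    show ?thesis unfolding I N t_def using u1 r ne(1) by (simp add: divide_simps)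
  qed
  ultimately have "second_intersection (pt u) (pt (- of_real r)) (sphere (pt (of_real (r\<^sup>2))) (cmod q * r / (1 - r\<^sup>2)))
      = pt (- of_real r) + t *\<^sub>R (pt u - pt (- of_real r))"
    by (rule second_intersection_eqI)
  also have "\<dots> = pt (u\<^sup>2)"
  proof -
    have t: "of_real t = (u + cnj u) / ((u + 1) * (cnj u + 1))"
      unfolding t_def of_real_divide complex_norm_square complex_add_cnj by simp
    have "pt (u\<^sup>2) - pt (- of_real r) = q * (u * (u + cnj u)) / ((u\<^sup>2 - 1) * (1 + of_real r))"
      unfolding mobius_point_diff[OF ne(8) ne(7)] using ne(8) r1 by (simp add: divide_simps) (use of_real_r in algebra)
    also have "\<dots> = of_real t * (pt u - pt (- of_real r))"
    proof -
      have "u\<^sup>2 - 1 = (u - 1) * (u + 1)" by algebra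
      then show ?thesis unfolding AS ur t using u1 c1 ne(1) r1 by (simp add: divide_simps)
    qed
    finally show ?thesis by (simp add: scaleR_conv_of_real algebra_simps)
  qed
  finally show ?thesis .
qed

text \<open>Squaring takes \<open>w * u\<close> to \<open>w\<^sup>2 * u\<^sup>2\<close>, which is
  why \<open>w\<^sup>2\<close> takes the place of \<open>w\<close>.\<close>

lemma second_brocard_triangle:
  "second_brocard_triangle (mobius_triangle p q w u) = mobius_triangle p q (w\<^sup>2) (u\<^sup>2)"
proof -
  interpret B: mobius_frame p q w "w * u" by (rule rotate)
  interpret C: mobius_frame p q w "w * (w * u)" by (rule B.rotate)
  have "w * (w * u) = w\<^sup>2 * u" by (simp add: power2_eq_square)
  then show ?thesis
    using second_intersection_vertex B.second_intersection_vertex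
      C.second_intersection_vertex[unfolded B.rotate_r rotate_r]
      symmedian_point[unfolded mobius_triangle_def] brocard_circle[unfolded mobius_triangle_def]
    unfolding B.rotate_r rotate_r mobius_triangle_def second_brocard_triangle.simps Let_def
    by (simp only: power_mult_distrib)
qed

text \<open>The frame conditions are carried through the induction so that the one-step result
  applies to each iterate.\<close>

lemma funpow_second_brocard_triangle:
  "mobius_frame q (if even n then w else w\<^sup>2) (u ^ 2 ^ n) \<and>
   (second_brocard_triangle ^^ n) (mobius_triangle p q w u)
     = mobius_triangle p q (if even n then w else w\<^sup>2) (u ^ 2 ^ n)"
proof (induction n)
  case 0
  show ?case using mobius_frame_axioms by simp
next
  case (Suc n)
  interpret N: mobius_frame p q "if even n then w else w\<^sup>2" "u ^ 2 ^ n" using Suc by blast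
  interpret N': mobius_frame p q "if even n then w else w\<^sup>2" "(u ^ 2 ^ n)\<^sup>2" by (rule N.square)
  have "u ^ 2 ^ Suc n = (u ^ 2 ^ n)\<^sup>2" by (simp add: power_mult[symmetric] mult.commute)
  moreover have "(if even (Suc n) then w else w\<^sup>2) = (if even n then w else w\<^sup>2)\<^sup>2"
    using w_simps by simp
  ultimately show ?case using N'.swap N.second_brocard_triangle Suc by simp
qed

section \<open>Beltrami points and circles\<close>

text \<open>In the coordinate, inversion in the circumcircle sends \<open>x\<close> to
  \<open>r / cnj x\<close>, hence \<open>w * r\<close> to \<open>w\<close>. The proof checks this
  through the real factor in the definition of the inverse.\<close>

lemma beltrami_U2: "beltrami_U2 (mobius_triangle p q w u) = pt w"
proof -
  define R where "R = cmod q * cmod u / (1 - r)"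
  have r01: "r \<noteq> 0" "r \<noteq> 1" using r by auto
  have w3: "(cmod (1 - w))\<^sup>2 = 3" 
    using cube_root_unity(1,2)[OF w] unfolding cmod_power2 by (simp add: power2_eq_square)
  have "cmod (of_real r - 1) = 1 - r" 
    using r by (metis abs_of_neg diff_less_0_iff_less minus_diff_eq norm_of_real of_real_1 of_real_diff)
  moreover have "cmod (w * of_real r - of_real r) = r * cmod (1 - w)"
    using r by (metis abs_of_pos left_diff_distrib mult_1 norm_minus_commute norm_mult norm_of_real mult.commute)
  ultimately have dist: "dist (pt (of_real r)) (pt (w * of_real r)) = cmod q * (r * cmod (1 - w)) / ((1 - r) * cmod (w * of_real r - 1))"
    unfolding dist_mobius_point[OF ne(4,5)] by simp
  have "R\<^sup>2 / (dist (pt (of_real r)) (pt (w * of_real r)))\<^sup>2 = (cmod (w * of_real r - 1))\<^sup>2 / (3 * r)"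
    using r q ne(5) unfolding R_def dist power_divide power_mult_distrib w3 r_def[symmetric]
    by (simp add: divide_simps) (simp add: power2_eq_square)
  then have k: "of_real (R\<^sup>2 / (dist (pt (of_real r)) (pt (w * of_real r)))\<^sup>2) = (w * of_real r - 1) * (w\<^sup>2 * of_real r - 1) / (3 * of_real r)"
    by (simp only: of_real_divide complex_norm_square) (simp add: w_simps)
  have "pt w - pt (of_real r) = (w * of_real r - 1) * (w\<^sup>2 * of_real r - 1) / (3 * of_real r) * (pt (w * of_real r) - pt (of_real r))"
    unfolding mobius_point_diff[OF ne(5,4)] mobius_point_diff[OF w_simps(7) ne(4)]
    by (simp add: divide_simps ne w_simps q r01) (use w in algebra)
  then have "pt w = pt (of_real r) + (R\<^sup>2 / (dist (pt (of_real r)) (pt (w * of_real r)))\<^sup>2) *\<^sub>R (pt (w * of_real r) - pt (of_real r))"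
    unfolding scaleR_conv_of_real k by (simp add: algebra_simps)
  then show ?thesis
    unfolding beltrami_U2_def inverse_in_circle_def circumcenter circumradius brocard_point2 R_def by simp
qed

lemma beltrami_P2: "beltrami_P2 (mobius_triangle p q w u) = pt (w\<^sup>2)"
proof -
  interpret S: mobius_frame p q "w\<^sup>2" u by (rule swap)
  have "(w\<^sup>2)\<^sup>2 = w" using w_simps by simp
  then show ?thesis
    using S.beltrami_U2 unfolding beltrami_P2_def beltrami_U2_def circumcenter circumradius
      S.circumcenter S.circumradius brocard_point1 S.brocard_point2 by simp
qed

text \<open>Reflection in the line through \<open>0\<close> and \<open>w\<^sup>2\<close> exchanges
  \<open>1\<close> and \<open>w\<close>. So \<open>w\<close> is the inverse of infinity in the image
  of this line, that is, its center; its points are equidistant from \<open>1\<close> and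
  \<open>w\<close>, and these two distances cancel.\<close>

lemma dist_beltrami: "dist (pt w) (pt (w\<^sup>2 * of_real s)) = cmod q / cmod (w - 1)"
proof -
  have ws: "w\<^sup>2 * of_real s \<noteq> 1"
  proof
    assume "w\<^sup>2 * of_real s = 1"
    then have "w * (w\<^sup>2 * of_real s) = w" by simp
    then have "of_real s = w" using w_simps by (simp add: mult.assoc[symmetric])
    then show False using w_simps by (metis Im_complex_of_real)
  qed
  have "cnj (w * (w\<^sup>2 * of_real s - 1)) = of_real s - w\<^sup>2"
    using w_simps(3) by (simp add: w_simps algebra_simps)
  moreover have "w\<^sup>2 * of_real s - w = w\<^sup>2 * (of_real s - w\<^sup>2)"
    using w by algebra
  ultimately have "cmod (w\<^sup>2 * of_real s - w) = cmod (w\<^sup>2 * cnj (w * (w\<^sup>2 * of_real s - 1)))"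
    by simp
  also have "\<dots> = cmod (w\<^sup>2 * of_real s - 1)"
    unfolding norm_mult complex_mod_cnj norm_power w_simps by simp
  finally show ?thesis
    unfolding dist_mobius_point[OF w_simps(7) ws] using ws by simp
qed

text \<open>The value \<open>s = r\<close> gives the Brocard point that defines the radius; other
  values of \<open>s\<close> serve the iterates.\<close>

lemma beltrami_circle1: "pt (w\<^sup>2 * of_real s) \<in> beltrami_circle1 (mobius_triangle p q w u)"
  by (simp add: beltrami_circle1_def beltrami_U2 brocard_point1 dist_beltrami)

lemma beltrami_circle2: "pt (w * of_real s) \<in> beltrami_circle2 (mobius_triangle p q w u)"
proof -
  interpret S: mobius_frame p q "w\<^sup>2" u by (rule swap)
  have "(w\<^sup>2)\<^sup>2 = w" using w_simps by simp
  then show ?thesis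
    using S.dist_beltrami by (simp add: beltrami_circle2_def beltrami_P2 brocard_point2)
qed

end

section \<open>Existence of the coordinates and conclusion\<close>

text \<open>Expanding \<open>1 / (w ^ k * u - 1)\<close> in powers of \<open>u\<close> shows that the discrete Fourier coefficients of
  the vertices are \<open>F = - 3 q u\<^sup>2 / (1 - u\<^sup>3)\<close> and \<open>G = - 3 q u / (1 - u\<^sup>3)\<close>; hence the choice of
  \<open>u\<close> and \<open>q\<close>. The orientation gives \<open>cmod F < cmod G\<close>, and \<open>F = 0\<close> means equilateral.\<close>

lemma counterclockwise_imp_mobius_triangle:
  assumes "counterclockwise T" "\<not> equilateral T"
  obtains p q w u where "mobius_frame q w u" "T = mobius_triangle p q w u"
proof -
  obtain A B C where T: "T = (A, B, C)" by (cases T)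
  \<comment> \<open>The primitive root in the upper half plane fits the counterclockwise
    orientation.\<close>
  define w where "w = Complex (- 1 / 2) (sqrt 3 / 2)"
  have w: "w\<^sup>2 + w + 1 = 0"
    by (simp add: w_def complex_eq_iff power2_eq_square)
  note root = cube_root_unity[OF w]
  have w1: "cmod w = 1" using root(1,2) by (simp add: cmod_def power_divide)
  define F G where "F = A + w * B + w\<^sup>2 * C" and "G = A + w\<^sup>2 * B + w * C"
  have "w\<^sup>2 = Complex (- 1 / 2) (- (sqrt 3 / 2))"
    unfolding root(3)[symmetric] by (simp add: w_def complex_eq_iff)
  then have "(cmod G)\<^sup>2 - (cmod F)\<^sup>2 = 2 * sqrt 3 * Im (cnj (B - A) * (C - A))"
    unfolding cmod_power2 F_def G_def w_def by (simp add: power2_eq_square) (simp add: algebra_simps)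
  moreover have "2 * sqrt 3 * Im (cnj (B - A) * (C - A)) > 0"
    using assms(1) by (intro mult_pos_pos) (simp_all add: T)
  ultimately have "(cmod F)\<^sup>2 < (cmod G)\<^sup>2" by linarith
  then have FG: "cmod F < cmod G" by (simp add: power_less_imp_less_base)
  have F0: "F \<noteq> 0"
  proof
    assume "F = 0"
    then have "A - C = w * (C - B)" "A - B = w\<^sup>2 * (B - C)" using w unfolding F_def by algebra+
    then have "cmod (A - C) = cmod (C - B)" "cmod (A - B) = cmod (B - C)"
      by (simp_all add: norm_mult norm_power w1)
    then show False using assms(2) by (simp add: T dist_norm norm_minus_commute)
  qed
  define u where "u = F / G"
  have G0: "G \<noteq> 0" using FG by auto
  have u: "u \<noteq> 0" "cmod u < 1" using F0 G0 FG by (auto simp: u_def norm_divide)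
  have u3: "u ^ 3 \<noteq> 1"
  proof
    assume "u ^ 3 = 1"
    then have "cmod u ^ 3 = 1" by (metis norm_one norm_power)
    then show False using u power_less_one_iff[of "cmod u" 3] by simp
  qed
  define q where "q = - (G * (1 - u ^ 3) / (3 * u))"
  \<comment> \<open>A translation that puts the first vertex at \<open>A\<close>; the other vertices
    are then compared through differences, where \<open>p\<close> cancels.\<close>
  define p where "p = A - q / (u - 1)"
  have q0: "q \<noteq> 0" using G0 u u3 by (simp add: q_def)
  have ne: "u \<noteq> 1" "w * u \<noteq> 1" "w\<^sup>2 * u \<noteq> 1"
    using u w1 by (auto dest!: arg_cong[of _ _ cmod] simp: norm_mult norm_power)
  have F: "F = u * G" using G0 by (simp add: u_def)
  have fac: "1 - u ^ 3 = - ((u - 1) * (w * u - 1) * (w\<^sup>2 * u - 1))" using w by algebra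
  have "mobius_point p q (w * u) - mobius_point p q u = B - A"
    unfolding mobius_point_diff[OF ne(2,1)] q_def fac using u ne
    by (simp add: divide_simps) (use w F in \<open>unfold F_def G_def, algebra\<close>)
  moreover have "mobius_point p q (w\<^sup>2 * u) - mobius_point p q u = C - A"
    unfolding mobius_point_diff[OF ne(3,1)] q_def fac using u ne
    by (simp add: divide_simps) (use w F in \<open>unfold F_def G_def, algebra\<close>)
  moreover have "mobius_point p q u = A" by (simp add: mobius_point_def p_def)
  ultimately have "T = mobius_triangle p q w u" by (simp add: T mobius_triangle_def)
  moreover have "mobius_frame q w u" using q0 w u by unfold_locales
  ultimately show thesis using that by blast
qed

theorem theorem3:
  fixes T :: triangle
  assumes "counterclockwise T" and "\<not> equilateral T"
  shows "(\<forall>n. (if even n then brocard_point1 ((second_brocard_triangle ^^ n) T)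
                else brocard_point2 ((second_brocard_triangle ^^ n) T)) \<in> beltrami_circle1 T) \<and>
         (\<forall>n. (if even n then brocard_point2 ((second_brocard_triangle ^^ n) T)
                else brocard_point1 ((second_brocard_triangle ^^ n) T)) \<in> beltrami_circle2 T)"
proof -
  obtain p q w u where "mobius_frame q w u" and T: "T = mobius_triangle p q w u"
    using assms by (rule counterclockwise_imp_mobius_triangle)
  then interpret mobius_frame p q w u by simp
  have "(if even n then brocard_point1 ((second_brocard_triangle ^^ n) T)
          else brocard_point2 ((second_brocard_triangle ^^ n) T)) \<in> beltrami_circle1 T \<and>
        (if even n then brocard_point2 ((second_brocard_triangle ^^ n) T)
          else brocard_point1 ((second_brocard_triangle ^^ n) T)) \<in> beltrami_circle2 T" for n
  proof -
    interpret N: mobius_frame p q "if even n then w else w\<^sup>2" "u ^ 2 ^ n"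
      using funpow_second_brocard_triangle by blast
    have "(second_brocard_triangle ^^ n) T = mobius_triangle p q (if even n then w else w\<^sup>2) (u ^ 2 ^ n)"
      using funpow_second_brocard_triangle T by blast
    \<comment> \<open>For odd \<open>n\<close> the frame has \<open>w\<^sup>2\<close> in place of
      \<open>w\<close>, and \<open>w ^ 4 = w\<close>: the Brocard points have exchanged the lines
      through \<open>w\<close> and \<open>w\<^sup>2\<close>, which the alternation of indices
      compensates.\<close>
    then show ?thesis
      using N.brocard_point1 N.brocard_point2 beltrami_circle1 beltrami_circle2 w_simps(4)
      by (cases "even n") (simp_all add: T)
  qed
  then show ?thesis by blast
qed

end
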